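(* Let $\Bbbk$ be a field of characteristic $0$ and let $(C^{p,q},d,\delta)_{p,q\ge0}$ be a first-quadrant bicomplex over $\Bbbk$ with $d^2=\delta^2=0$ and $[d,\delta]=0$. For $t\in\Bbbk$ define $D_t|_{C^{p,q}}:=d+(-1)^p t\,\delta$. Let $T|_{C^{p,q}}:=(-1)^q\mathrm{id}$ and, for $c\in\Bbbk^\times$, $S_c|_{C^{p,q}}:=c^{q}\,\mathrm{id}$. Then $$T\,D_t\,T^{-1}=D_{-t},\qquad S_c\,D_t\,S_c^{-1}=D_{ct}.$$ In particular, for $t\neq0$, $$H^\bullet(C,D_t)\cong H^\bullet(C,D_{-t})\cong H^\bullet(C,D_1).$$
   Context: Here $d:C^{p,q}\to C^{p+1,q}$, $\delta:C^{p,q}\to C^{p,q+1}$, $[d,\delta]=d\delta-\delta d$, and $C$ denotes the total complex $C^N=\bigoplus_{p+q=N}C^{p,q}$ with differential $D_t$. *)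

theory Defs
  imports "HOL-Algebra.Module" "HOL-Algebra.AbelCoset"
begin

section \<open>Linear algebra over a field given as a ring record\<close>

definition char_zero :: "('k, 'm) ring_scheme \<Rightarrow> bool"
  where "char_zero K \<longleftrightarrow> (\<forall>n::nat. n > 0 \<longrightarrow> [n] \<cdot>\<^bsub>K\<^esub> \<one>\<^bsub>K\<^esub> \<noteq> \<zero>\<^bsub>K\<^esub>)"

definition lin_hom ::
    "('k, 'm) ring_scheme \<Rightarrow> ('k, 'a) module \<Rightarrow> ('k, 'b) module \<Rightarrow> ('a \<Rightarrow> 'b) set"
  where "lin_hom K M N =
    {f \<in> carrier M \<rightarrow> carrier N.
       (\<forall>x\<in>carrier M. \<forall>y\<in>carrier M. f (x \<oplus>\<^bsub>M\<^esub> y) = f x \<oplus>\<^bsub>N\<^esub> f y) \<and>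
       (\<forall>a\<in>carrier K. \<forall>x\<in>carrier M. f (a \<odot>\<^bsub>M\<^esub> x) = a \<odot>\<^bsub>N\<^esub> f x)}"

definition lin_iso ::
    "('k, 'm) ring_scheme \<Rightarrow> ('k, 'a) module \<Rightarrow> ('k, 'b) module \<Rightarrow> ('a \<Rightarrow> 'b) set"
  where "lin_iso K M N = {f \<in> lin_hom K M N. bij_betw f (carrier M) (carrier N)}"

definition lin_isomorphic ::
    "('k, 'm) ring_scheme \<Rightarrow> ('k, 'a) module \<Rightarrow> ('k, 'b) module \<Rightarrow> bool"
  where "lin_isomorphic K M N \<longleftrightarrow> lin_iso K M N \<noteq> {}"

text \<open>
  As for quotient rings in HOL-Algebra, the elements are the additive cosets. The multiplicative
  fields of the record carry no meaning for a module.
\<close>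

definition quot_module :: "('k, 'a) module \<Rightarrow> 'a set \<Rightarrow> ('k, 'a set) module"
  where "quot_module M B =
    \<lparr>carrier = a_rcosets\<^bsub>M\<^esub> B, mult = undefined, one = undefined,
     zero = B, add = set_add M, smult = (\<lambda>a X. \<Union>x\<in>X. B +>\<^bsub>M\<^esub> (a \<odot>\<^bsub>M\<^esub> x))\<rparr>"

section \<open>Cohomology of a cochain complex in degrees at least 0\<close>

definition coboundaries :: "(nat \<Rightarrow> ('k, 'a) module) \<Rightarrow> (nat \<Rightarrow> 'a \<Rightarrow> 'a) \<Rightarrow> nat \<Rightarrow> 'a set"
  where "coboundaries M D N =
    (case N of 0 \<Rightarrow> {\<zero>\<^bsub>M 0\<^esub>} | Suc n \<Rightarrow> D n ` carrier (M n))"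

definition cohomology ::
    "(nat \<Rightarrow> ('k, 'a) module) \<Rightarrow> (nat \<Rightarrow> 'a \<Rightarrow> 'a) \<Rightarrow> nat \<Rightarrow> ('k, 'a set) module"
  where "cohomology M D N =
    quot_module ((M N)\<lparr>carrier := a_kernel (M N) (M (Suc N)) (D N)\<rparr>) (coboundaries M D N)"

section \<open>Bicomplexes and their total complexes\<close>

locale bicomplex = field K for K (structure) +
  fixes C :: "nat \<Rightarrow> nat \<Rightarrow> ('a, 'v) module"
    and d \<delta> :: "nat \<Rightarrow> nat \<Rightarrow> 'v \<Rightarrow> 'v"
  assumes vector_space: "module K (C p q)"
    and d_linear: "d p q \<in> lin_hom K (C p q) (C (Suc p) q)"
    and \<delta>_linear: "\<delta> p q \<in> lin_hom K (C p q) (C p (Suc q))"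
    and d_square:
      "x \<in> carrier (C p q) \<Longrightarrow> d (Suc p) q (d p q x) = \<zero>\<^bsub>C (Suc (Suc p)) q\<^esub>"
    and \<delta>_square:
      "x \<in> carrier (C p q) \<Longrightarrow> \<delta> p (Suc q) (\<delta> p q x) = \<zero>\<^bsub>C p (Suc (Suc q))\<^esub>"
    and commutator:
      "x \<in> carrier (C p q) \<Longrightarrow>
         d p (Suc q) (\<delta> p q x) \<ominus>\<^bsub>C (Suc p) (Suc q)\<^esub> \<delta> (Suc p) q (d p q x)
           = \<zero>\<^bsub>C (Suc p) (Suc q)\<^esub>"

definition bidegrees :: "nat \<Rightarrow> (nat \<times> nat) set"
  where "bidegrees N = {(p, q). p + q = N}"

text \<open>
  The direct sum of the \<open>C p q\<close> with \<open>p + q = N\<close>, a finite set of bidegrees, realised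
  as families of components.
\<close>

definition total_complex :: "(nat \<Rightarrow> nat \<Rightarrow> ('k, 'v) module) \<Rightarrow> nat \<Rightarrow> ('k, nat \<times> nat \<Rightarrow> 'v) module"
  where "total_complex C N =
    \<lparr>carrier = (\<Pi>\<^sub>E (p, q)\<in>bidegrees N. carrier (C p q)), mult = undefined, one = undefined,
     zero = (\<lambda>(p, q)\<in>bidegrees N. \<zero>\<^bsub>C p q\<^esub>),
     add = (\<lambda>x y. \<lambda>(p, q)\<in>bidegrees N. x (p, q) \<oplus>\<^bsub>C p q\<^esub> y (p, q)),
     smult = (\<lambda>a x. \<lambda>(p, q)\<in>bidegrees N. a \<odot>\<^bsub>C p q\<^esub> x (p, q))\<rparr>"

text \<open>
  \<open>D\<^sub>t\<close>, the linear extension of \<open>d + (-1)\<^sup>p t \<delta>\<close> on \<open>C p q\<close>, is written by components of its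
  value: the component in bidegree \<open>(p, q)\<close> receives \<open>d\<close> of the component \<open>(p - 1, q)\<close> and
  \<open>(-1)\<^sup>p t \<delta>\<close> of the component \<open>(p, q - 1)\<close>. The fact \<open>total_diff_summand\<close> below recovers the
  formula on a single summand.
\<close>

definition total_diff ::
    "('k, 'm) ring_scheme \<Rightarrow> (nat \<Rightarrow> nat \<Rightarrow> ('k, 'v) module) \<Rightarrow>
     (nat \<Rightarrow> nat \<Rightarrow> 'v \<Rightarrow> 'v) \<Rightarrow> (nat \<Rightarrow> nat \<Rightarrow> 'v \<Rightarrow> 'v) \<Rightarrow>
     'k \<Rightarrow> nat \<Rightarrow> (nat \<times> nat \<Rightarrow> 'v) \<Rightarrow> (nat \<times> nat \<Rightarrow> 'v)"
  where "total_diff K C d \<delta> t N x =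
    (\<lambda>(p, q)\<in>bidegrees (Suc N).
       (case p of 0 \<Rightarrow> \<zero>\<^bsub>C p q\<^esub> | Suc p' \<Rightarrow> d p' q (x (p', q)))
       \<oplus>\<^bsub>C p q\<^esub>
       (case q of 0 \<Rightarrow> \<zero>\<^bsub>C p q\<^esub>
        | Suc q' \<Rightarrow> ((\<ominus>\<^bsub>K\<^esub> \<one>\<^bsub>K\<^esub>) [^]\<^bsub>K\<^esub> p \<otimes>\<^bsub>K\<^esub> t) \<odot>\<^bsub>C p q\<^esub> \<delta> p q' (x (p, q'))))"

definition sign_twist ::
    "('k, 'm) ring_scheme \<Rightarrow> (nat \<Rightarrow> nat \<Rightarrow> ('k, 'v) module) \<Rightarrow>
     nat \<Rightarrow> (nat \<times> nat \<Rightarrow> 'v) \<Rightarrow> (nat \<times> nat \<Rightarrow> 'v)"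
  where "sign_twist K C N x =
    (\<lambda>(p, q)\<in>bidegrees N. ((\<ominus>\<^bsub>K\<^esub> \<one>\<^bsub>K\<^esub>) [^]\<^bsub>K\<^esub> q) \<odot>\<^bsub>C p q\<^esub> x (p, q))"

definition rescaling ::
    "('k, 'm) ring_scheme \<Rightarrow> (nat \<Rightarrow> nat \<Rightarrow> ('k, 'v) module) \<Rightarrow>
     'k \<Rightarrow> nat \<Rightarrow> (nat \<times> nat \<Rightarrow> 'v) \<Rightarrow> (nat \<times> nat \<Rightarrow> 'v)"
  where "rescaling K C c N x =
    (\<lambda>(p, q)\<in>bidegrees N. (c [^]\<^bsub>K\<^esub> q) \<odot>\<^bsub>C p q\<^esub> x (p, q))"

definition summand ::
    "(nat \<Rightarrow> nat \<Rightarrow> ('k, 'v) module) \<Rightarrow> nat \<Rightarrow> nat \<Rightarrow> 'v \<Rightarrow> (nat \<times> nat \<Rightarrow> 'v)"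
  where "summand C p q v =
    (\<lambda>(i, j)\<in>bidegrees (p + q). if (i, j) = (p, q) then v else \<zero>\<^bsub>C i j\<^esub>)"

context bicomplex
begin

lemma lin_hom_zero:
  assumes "f \<in> lin_hom K M N" "module K M" "module K N"
  shows "f \<zero>\<^bsub>M\<^esub> = \<zero>\<^bsub>N\<^esub>"
proof -
  interpret M: module K M by fact
  interpret N: module K N by fact
  have "f (\<zero> \<odot>\<^bsub>M\<^esub> \<zero>\<^bsub>M\<^esub>) = \<zero> \<odot>\<^bsub>N\<^esub> f \<zero>\<^bsub>M\<^esub>" "f \<zero>\<^bsub>M\<^esub> \<in> carrier N"
    using assms(1) M.zero_closed zero_closed unfolding lin_hom_def by blast+
  then show ?thesis by simp
qed

lemma total_diff_summand:
  assumes t: "t \<in> carrier K" and v: "v \<in> carrier (C p q)"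
  shows "total_diff K C d \<delta> t (p + q) (summand C p q v) =
    summand C (Suc p) q (d p q v) \<oplus>\<^bsub>total_complex C (Suc (p + q))\<^esub>
    summand C p (Suc q) (((\<ominus>\<^bsub>K\<^esub> \<one>\<^bsub>K\<^esub>) [^]\<^bsub>K\<^esub> p \<otimes>\<^bsub>K\<^esub> t) \<odot>\<^bsub>C p (Suc q)\<^esub> \<delta> p q v)"
proof -
  have dz: "d i j \<zero>\<^bsub>C i j\<^esub> = \<zero>\<^bsub>C (Suc i) j\<^esub>" and ez: "\<delta> i j \<zero>\<^bsub>C i j\<^esub> = \<zero>\<^bsub>C i (Suc j)\<^esub>" for i j
    using lin_hom_zero d_linear \<delta>_linear vector_space by blast+
  have sz: "a \<odot>\<^bsub>C i j\<^esub> \<zero>\<^bsub>C i j\<^esub> = \<zero>\<^bsub>C i j\<^esub>" if "a \<in> carrier K" for a i j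
    using module.smult_r_null[OF vector_space that] .
  show ?thesis
    by (rule ext) (auto simp: total_diff_def summand_def total_complex_def restrict_def bidegrees_def
        dz ez sz t split: nat.splits)
qed

end

end

theory Submission
  imports Defs
begin

text \<open>
  The map \<open>S\<^sub>c\<close> is invertible with inverse \<open>S\<close> at \<open>c\<inverse>\<close>. It commutes with \<open>d\<close>, which preserves \<open>q\<close>,
  while moving it past \<open>\<delta>\<close>, which raises \<open>q\<close> by one, costs a factor \<open>c\<close>; hence
  \<open>S\<^sub>c D\<^sub>t = D\<^sub>c\<^sub>t S\<^sub>c\<close>. The map \<open>T\<close> is \<open>S\<^sub>c\<close> for \<open>c = -1\<close>. An invertible chain map induces an
  isomorphism on cohomology, and for \<open>t \<noteq> 0\<close> the choices \<open>c = -1\<close> and \<open>c = (-t)\<inverse>\<close> give the two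
  isomorphisms.
\<close>

section \<open>Induced isomorphisms on quotients and cohomology\<close>

lemma a_r_coset_eq: "B +>\<^bsub>M\<^esub> x = (\<lambda>b. b \<oplus>\<^bsub>M\<^esub> x) ` B"
  by (auto simp: a_r_coset_def r_coset_def)

lemma set_add_eq: "X <+>\<^bsub>M\<^esub> Y = (\<lambda>(x, y). x \<oplus>\<^bsub>M\<^esub> y) ` (X \<times> Y)"
  by (auto simp: set_add_def set_mult_def)

lemma lin_homD:
  assumes "f \<in> lin_hom K M N"
  shows "x \<in> carrier M \<Longrightarrow> f x \<in> carrier N"
    and "x \<in> carrier M \<Longrightarrow> y \<in> carrier M \<Longrightarrow> f (x \<oplus>\<^bsub>M\<^esub> y) = f x \<oplus>\<^bsub>N\<^esub> f y"
    and "a \<in> carrier K \<Longrightarrow> x \<in> carrier M \<Longrightarrow> f (a \<odot>\<^bsub>M\<^esub> x) = a \<odot>\<^bsub>N\<^esub> f x"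
  using assms by (auto simp: lin_hom_def)

text \<open>
  The isomorphism is the image map on cosets. It respects the operations for arbitrary subsets \<open>B\<close>
  and \<open>Z\<close>, so the quotients need not be shown to be modules, nor \<open>B \<subseteq> Z\<close>.
\<close>

lemma lin_isomorphic_quot_module:
  assumes M: "module K M" and f: "f \<in> lin_iso K M M'" and B: "B \<subseteq> carrier M"
    and Z: "Z \<subseteq> carrier M"
  shows "lin_isomorphic K (quot_module (M\<lparr>carrier := Z\<rparr>) B)
    (quot_module (M'\<lparr>carrier := f ` Z\<rparr>) (f ` B))"
proof -
  interpret M: module K M by fact
  have hom: "f \<in> lin_hom K M M'" and bij: "bij_betw f (carrier M) (carrier M')"
    using f by (auto simp: lin_iso_def)
  note f_add = lin_homD(2)[OF hom] and f_smult = lin_homD(3)[OF hom]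
  let ?Q = "quot_module (M\<lparr>carrier := Z\<rparr>) B"
  let ?Q' = "quot_module (M'\<lparr>carrier := f ` Z\<rparr>) (f ` B)"
  \<comment> \<open>Updating the carrier to \<open>Z\<close> changes only which cosets occur: a
    coset, and a sum of cosets, depends on the addition alone, so both can be computed in
    \<open>M\<close>.\<close>
  have carrier_Q: "carrier ?Q = (\<lambda>z. B +>\<^bsub>M\<^esub> z) ` Z"
    and carrier_Q': "carrier ?Q' = (\<lambda>z. f ` B +>\<^bsub>M'\<^esub> z) ` (f ` Z)"
    by (auto simp: quot_module_def A_RCOSETS_def RCOSETS_def a_r_coset_def r_coset_def)
  have coset: "f ` (B +>\<^bsub>M\<^esub> x) = f ` B +>\<^bsub>M'\<^esub> f x" if "x \<in> carrier M" for x
    unfolding a_r_coset_eq image_image using that B f_add by (intro image_cong) auto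
  \<comment> \<open>\<open>f\<close> is injective and linear only on \<open>carrier M\<close>. Its
    image map is therefore injective and compatible with the operations on subsets of
    \<open>carrier M\<close>, and every coset in \<open>?Q\<close> is one.\<close>
  have sub: "X \<subseteq> carrier M" if "X \<in> carrier ?Q" for X
    using that B Z unfolding carrier_Q a_r_coset_eq by auto
  have "(`) f ` carrier ?Q = carrier ?Q'"
    unfolding carrier_Q carrier_Q' image_image using coset Z by (intro image_cong) auto
  moreover have "inj_on ((`) f) (carrier ?Q)"
    using sub bij by (intro inj_onI) (meson bij_betw_imp_inj_on inj_on_image_eq_iff)
  ultimately have "bij_betw ((`) f) (carrier ?Q) (carrier ?Q')"
    by (simp add: bij_betw_def)
  moreover have "f ` (X \<oplus>\<^bsub>?Q\<^esub> Y) = f ` X \<oplus>\<^bsub>?Q'\<^esub> f ` Y"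
    if "X \<in> carrier ?Q" "Y \<in> carrier ?Q" for X Y
  proof -
    have "f ` (X <+>\<^bsub>M\<^esub> Y) = f ` X <+>\<^bsub>M'\<^esub> f ` Y"
      unfolding set_add_eq using sub[OF that(1)] sub[OF that(2)] f_add
      by (force simp: image_iff subset_iff)
    then show ?thesis
      by (simp add: quot_module_def set_add_def set_mult_def)
  qed
  moreover have "f ` (a \<odot>\<^bsub>?Q\<^esub> X) = a \<odot>\<^bsub>?Q'\<^esub> f ` X"
    if "a \<in> carrier K" "X \<in> carrier ?Q" for a X
  proof -
    have "f ` (\<Union>x\<in>X. B +>\<^bsub>M\<^esub> (a \<odot>\<^bsub>M\<^esub> x)) = (\<Union>x\<in>X. f ` (B +>\<^bsub>M\<^esub> (a \<odot>\<^bsub>M\<^esub> x)))"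
      by (rule image_UN)
    also have "\<dots> = (\<Union>x\<in>X. f ` B +>\<^bsub>M'\<^esub> (a \<odot>\<^bsub>M'\<^esub> f x))"
    proof (rule SUP_cong[OF refl])
      fix x assume "x \<in> X"
      then have "x \<in> carrier M" using sub[OF that(2)] by blast
      then show "f ` (B +>\<^bsub>M\<^esub> (a \<odot>\<^bsub>M\<^esub> x)) = f ` B +>\<^bsub>M'\<^esub> (a \<odot>\<^bsub>M'\<^esub> f x)"
        using that(1) by (simp add: coset f_smult)
    qed
    finally show ?thesis
      by (simp add: quot_module_def a_r_coset_def r_coset_def)
  qed
  ultimately have "(`) f \<in> lin_iso K ?Q ?Q'"
    unfolding lin_iso_def lin_hom_def by (auto dest: bij_betwE)
  then show ?thesis
    unfolding lin_isomorphic_def by blast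
qed

text \<open>In each degree \<open>f\<close> carries the kernel of \<open>D\<close> onto that of
  \<open>D'\<close> and the coboundaries of \<open>D\<close> onto those of \<open>D'\<close>, so the
  quotient isomorphism applies with \<open>Z\<close> the kernel and \<open>B\<close> the
  coboundaries.\<close>

lemma (in bicomplex) lin_isomorphic_cohomology:
  assumes M: "\<And>n. module K (M n)" and M': "\<And>n. module K (M' n)"
    and D: "\<And>n. D n \<in> carrier (M n) \<rightarrow> carrier (M (Suc n))"
    and f: "\<And>n. f n \<in> lin_iso K (M n) (M' n)"
    and comm: "\<And>n x. x \<in> carrier (M n) \<Longrightarrow> f (Suc n) (D n x) = D' n (f n x)"
  shows "lin_isomorphic K (cohomology M D N) (cohomology M' D' N)"
proof -
  have hom: "f n \<in> lin_hom K (M n) (M' n)" and inj: "inj_on (f n) (carrier (M n))"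
    and surj: "f n ` carrier (M n) = carrier (M' n)" for n
    using f[of n] by (auto simp: lin_iso_def bij_betw_def)
  have zero: "f n \<zero>\<^bsub>M n\<^esub> = \<zero>\<^bsub>M' n\<^esub>" for n
    using lin_hom_zero[OF hom M M'] .
  have zero_in: "\<zero>\<^bsub>M n\<^esub> \<in> carrier (M n)" for n
  proof -
    interpret module K "M n" by (rule M)
    show ?thesis by simp
  qed
  let ?Z = "a_kernel (M N) (M (Suc N)) (D N)"
  \<comment> \<open>The left side is \<open>f (Suc N) (D N x)\<close>, and \<open>f (Suc N)\<close>
    is injective and fixes zero. With surjectivity of \<open>f N\<close> this gives both inclusions
    between the kernels.\<close>
  have "D' N (f N x) = \<zero>\<^bsub>M' (Suc N)\<^esub> \<longleftrightarrow> D N x = \<zero>\<^bsub>M (Suc N)\<^esub>" if "x \<in> carrier (M N)" for x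
    using that comm[OF that] D[of N] inj_on_eq_iff[OF inj[of "Suc N"]] zero[of "Suc N"] zero_in
    by (metis Pi_iff)
  then have "a_kernel (M' N) (M' (Suc N)) (D' N) = f N ` ?Z"
    unfolding a_kernel_def kernel_def by (auto simp: surj[symmetric])
  \<comment> \<open>In degree 0 this is preservation of zero; in degree \<open>Suc n\<close> it is
    commutation with the differentials together with surjectivity of \<open>f n\<close>.\<close>
  moreover have "coboundaries M' D' N = f N ` coboundaries M D N"
    using zero comm by (auto simp: coboundaries_def surj[symmetric] image_iff split: nat.split)
  moreover have "coboundaries M D N \<subseteq> carrier (M N)"
    using zero_in D by (auto simp: coboundaries_def split: nat.split)
  moreover have "?Z \<subseteq> carrier (M N)"
    by (auto simp: a_kernel_def kernel_def)
  ultimately show ?thesis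
    unfolding cohomology_def using lin_isomorphic_quot_module[OF M f] by simp
qed

section \<open>The total complex and its rescaling maps\<close>

lemma sign_twist_eq_rescaling: "sign_twist K C N = rescaling K C (\<ominus>\<^bsub>K\<^esub> \<one>\<^bsub>K\<^esub>) N"
  by (simp add: sign_twist_def rescaling_def fun_eq_iff)

lemma total_complex_carrier:
  "x \<in> carrier (total_complex C N) \<longleftrightarrow>
    x \<in> extensional (bidegrees N) \<and> (\<forall>(p, q)\<in>bidegrees N. x (p, q) \<in> carrier (C p q))"
  by (auto simp: total_complex_def PiE_iff)

lemma total_complex_ops:
  "\<zero>\<^bsub>total_complex C N\<^esub> = (\<lambda>(p, q)\<in>bidegrees N. \<zero>\<^bsub>C p q\<^esub>)"
  "x \<oplus>\<^bsub>total_complex C N\<^esub> y = (\<lambda>(p, q)\<in>bidegrees N. x (p, q) \<oplus>\<^bsub>C p q\<^esub> y (p, q))"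
  "a \<odot>\<^bsub>total_complex C N\<^esub> x = (\<lambda>(p, q)\<in>bidegrees N. a \<odot>\<^bsub>C p q\<^esub> x (p, q))"
  by (simp_all add: total_complex_def)

lemmas total_complex_simps = total_complex_carrier total_complex_ops

context bicomplex
begin

text \<open>Every axiom holds in each component, and two families that are \<open>undefined\<close>
  outside \<open>bidegrees N\<close> agree once their components do.\<close>

lemma total_complex_module: "module K (total_complex C N)"
proof -
  interpret C: module K "C p q" for p q by (rule vector_space)
  have "abelian_group (total_complex C N)"
  proof (rule abelian_groupI)
    fix x assume x: "x \<in> carrier (total_complex C N)"
    then show "\<exists>y\<in>carrier (total_complex C N).
        y \<oplus>\<^bsub>total_complex C N\<^esub> x = \<zero>\<^bsub>total_complex C N\<^esub>"
      by (intro bexI[of _ "\<lambda>(p, q)\<in>bidegrees N. \<ominus>\<^bsub>C p q\<^esub> x (p, q)"])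
        (fastforce simp: total_complex_simps fun_eq_iff C.l_neg)+
  next
    \<comment> \<open>The right side is \<open>x\<close> itself rather than a restricted family, so
      \<open>extensional_def\<close> supplies its value outside \<open>bidegrees N\<close>. The unit
      law for scalars below needs the same.\<close>
    fix x assume "x \<in> carrier (total_complex C N)"
    then show "\<zero>\<^bsub>total_complex C N\<^esub> \<oplus>\<^bsub>total_complex C N\<^esub> x = x"
      by (fastforce simp: total_complex_simps fun_eq_iff extensional_def)
  qed (fastforce simp: total_complex_simps fun_eq_iff C.a_ac)+
  moreover have "\<one> \<odot>\<^bsub>total_complex C N\<^esub> x = x" if "x \<in> carrier (total_complex C N)" for x
    using that by (fastforce simp: total_complex_simps fun_eq_iff extensional_def)
  ultimately show ?thesis
    by (intro moduleI is_cring)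
      (fastforce simp: total_complex_simps fun_eq_iff C.smult_l_distr C.smult_r_distr
        C.smult_assoc1)+
qed

lemma total_complexD:
  "x \<in> carrier (total_complex C N) \<Longrightarrow> p + q = N \<Longrightarrow> x (p, q) \<in> carrier (C p q)"
  by (auto simp: total_complex_carrier bidegrees_def)

text \<open>Since scalars commute, \<open>a [^] q \<otimes> b [^] q\<close> is
  \<open>(a \<otimes> b) [^] q\<close>. With \<open>rescaling_one\<close> this makes the units of
  \<open>K\<close> act on the total complex, which yields the inverse maps.\<close>

lemma rescaling_rescaling:
  assumes a: "a \<in> carrier K" and b: "b \<in> carrier K" and x: "x \<in> carrier (total_complex C N)"
  shows "rescaling K C a N (rescaling K C b N x) = rescaling K C (a \<otimes> b) N x"
  using total_complexD[OF x] a b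
  by (auto simp: rescaling_def restrict_def fun_eq_iff bidegrees_def nat_pow_distrib
      module.smult_assoc1[OF vector_space])

lemma rescaling_one: "x \<in> carrier (total_complex C N) \<Longrightarrow> rescaling K C \<one> N x = x"
  by (auto simp: rescaling_def total_complex_def restrict_def fun_eq_iff PiE_iff extensional_def
      module.smult_one[OF vector_space])

lemma rescaling_lin_hom:
  assumes c: "c \<in> carrier K"
  shows "rescaling K C c N \<in> lin_hom K (total_complex C N) (total_complex C N)"
proof -
  interpret C: module K "C p q" for p q by (rule vector_space)
  show ?thesis
    using c by (fastforce simp: lin_hom_def rescaling_def total_complex_simps fun_eq_iff m_comm
        C.smult_r_distr C.smult_assoc1[symmetric])
qed

lemma rescaling_bij:
  assumes c: "c \<in> Units K"
  shows "bij_betw (rescaling K C c N) (carrier (total_complex C N)) (carrier (total_complex C N))"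
  using c lin_homD(1)[OF rescaling_lin_hom]
  by (intro bij_betw_byWitness[where f' = "rescaling K C (inv c) N"])
    (auto simp: rescaling_rescaling rescaling_one Units_closed)

lemma rescaling_lin_iso:
  assumes c: "c \<in> Units K"
  shows "rescaling K C c N \<in> lin_iso K (total_complex C N) (total_complex C N)"
  using rescaling_lin_hom[of c] rescaling_bij[OF c] Units_closed[OF c] by (simp add: lin_iso_def)

section \<open>The total differential under rescaling, and the effect on cohomology\<close>

lemma total_diff_closed:
  assumes t: "t \<in> carrier K"
  shows "total_diff K C d \<delta> t N \<in> carrier (total_complex C N) \<rightarrow> carrier (total_complex C (Suc N))"
proof
  interpret C: module K "C p q" for p q by (rule vector_space)
  fix x assume x: "x \<in> carrier (total_complex C N)"
  show "total_diff K C d \<delta> t N x \<in> carrier (total_complex C (Suc N))"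
    using t total_complexD[OF x] lin_homD(1)[OF d_linear] lin_homD(1)[OF \<delta>_linear]
    by (auto simp: total_diff_def total_complex_def bidegrees_def split: nat.split
        intro!: C.smult_closed C.a_closed)
qed

text \<open>The intertwining form of the conjugation formula involves no inverse, so it holds for
  every scalar \<open>c\<close>. It is checked in each target bidegree \<open>(p, q)\<close>, where
  one term arrives from \<open>(p - 1, q)\<close> with the same power of \<open>c\<close> and the
  other from \<open>(p, q - 1)\<close> with one power fewer.\<close>

lemma rescaling_total_diff:
  assumes c: "c \<in> carrier K" and t: "t \<in> carrier K" and x: "x \<in> carrier (total_complex C N)"
  shows "rescaling K C c (Suc N) (total_diff K C d \<delta> t N x)
    = total_diff K C d \<delta> (c \<otimes> t) N (rescaling K C c N x)"
proof (rule ext, clarify)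
  fix p q
  interpret C: module K "C p q" for p q by (rule vector_space)
  note d_closed = lin_homD(1)[OF d_linear] and \<delta>_closed = lin_homD(1)[OF \<delta>_linear]
  let ?s = "(\<ominus> \<one>) [^] p"
  \<comment> \<open>Source and target share the index \<open>q\<close>, so linearity of
    \<open>d\<close> moves the scalar inside; for \<open>p = 0\<close> both sides are zero.\<close>
  have d_term: "c [^] q \<odot>\<^bsub>C p q\<^esub> (case p of 0 \<Rightarrow> \<zero>\<^bsub>C p q\<^esub> | Suc p' \<Rightarrow> d p' q (x (p', q)))
    = (case p of 0 \<Rightarrow> \<zero>\<^bsub>C p q\<^esub> | Suc p' \<Rightarrow> d p' q (c [^] q \<odot>\<^bsub>C p' q\<^esub> x (p', q)))"
    if "p + q = Suc N"
    using that c total_complexD[OF x] by (auto simp: lin_homD(3)[OF d_linear] split: nat.split)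
  have "c [^] Suc r \<odot>\<^bsub>C p (Suc r)\<^esub> ((?s \<otimes> t) \<odot>\<^bsub>C p (Suc r)\<^esub> \<delta> p r (x (p, r)))
    = (?s \<otimes> (c \<otimes> t)) \<odot>\<^bsub>C p (Suc r)\<^esub> \<delta> p r (c [^] r \<odot>\<^bsub>C p r\<^esub> x (p, r))"
    if "p + r = N" for r
  proof -
    \<comment> \<open>The surplus factor \<open>c\<close> joins the parameter \<open>t\<close>, and
      \<open>c [^] r\<close> remains for \<open>x (p, r)\<close>.\<close>
    have "c [^] Suc r \<otimes> (?s \<otimes> t) = ?s \<otimes> (c \<otimes> t) \<otimes> c [^] r"
      using c t by (simp add: m_ac)
    \<comment> \<open>Removing \<open>nat_pow_Suc\<close> from the simplifier keeps
      \<open>c [^] Suc r\<close> in the form in which the scalar identity can rewrite it.\<close>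
    then show ?thesis
      using c t \<delta>_closed[OF total_complexD[OF x that]] total_complexD[OF x that]
      by (simp add: lin_homD(3)[OF \<delta>_linear] C.smult_assoc1[symmetric] del: nat_pow_Suc)
  qed
  then have \<delta>_term: "c [^] q \<odot>\<^bsub>C p q\<^esub> (case q of 0 \<Rightarrow> \<zero>\<^bsub>C p q\<^esub>
      | Suc r \<Rightarrow> (?s \<otimes> t) \<odot>\<^bsub>C p q\<^esub> \<delta> p r (x (p, r)))
    = (case q of 0 \<Rightarrow> \<zero>\<^bsub>C p q\<^esub>
      | Suc r \<Rightarrow> (?s \<otimes> (c \<otimes> t)) \<odot>\<^bsub>C p q\<^esub> \<delta> p r (c [^] r \<odot>\<^bsub>C p r\<^esub> x (p, r)))"
    if "p + q = Suc N"
    using that c by (auto split: nat.split)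
  \<comment> \<open>Distributing \<open>c [^] q\<close> over the sum of the two terms requires both
    to lie in \<open>C p q\<close>.\<close>
  have closed: "(case p of 0 \<Rightarrow> \<zero>\<^bsub>C p q\<^esub> | Suc p' \<Rightarrow> d p' q (x (p', q))) \<in> carrier (C p q)"
    "(case q of 0 \<Rightarrow> \<zero>\<^bsub>C p q\<^esub> | Suc r \<Rightarrow> (?s \<otimes> t) \<odot>\<^bsub>C p q\<^esub> \<delta> p r (x (p, r)))
      \<in> carrier (C p q)"
    if "p + q = Suc N"
    using that t total_complexD[OF x] d_closed \<delta>_closed by (auto split: nat.split)
  have "c [^] q \<odot>\<^bsub>C p q\<^esub> total_diff K C d \<delta> t N x (p, q)
    = total_diff K C d \<delta> (c \<otimes> t) N (rescaling K C c N x) (p, q)" if pq: "p + q = Suc N"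
  proof -
    have "c [^] q \<odot>\<^bsub>C p q\<^esub> total_diff K C d \<delta> t N x (p, q)
      = (case p of 0 \<Rightarrow> \<zero>\<^bsub>C p q\<^esub> | Suc p' \<Rightarrow> d p' q (c [^] q \<odot>\<^bsub>C p' q\<^esub> x (p', q)))
      \<oplus>\<^bsub>C p q\<^esub> (case q of 0 \<Rightarrow> \<zero>\<^bsub>C p q\<^esub>
        | Suc r \<Rightarrow> (?s \<otimes> (c \<otimes> t)) \<odot>\<^bsub>C p q\<^esub> \<delta> p r (c [^] r \<odot>\<^bsub>C p r\<^esub> x (p, r)))"
      using pq c closed[OF pq]
      by (simp add: total_diff_def bidegrees_def C.smult_r_distr d_term[OF pq] \<delta>_term[OF pq])
    also have "\<dots> = total_diff K C d \<delta> (c \<otimes> t) N (rescaling K C c N x) (p, q)"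
      using pq by (auto simp: total_diff_def rescaling_def bidegrees_def split: nat.split)
    finally show ?thesis .
  qed
  \<comment> \<open>Outside \<open>bidegrees (Suc N)\<close> both sides are
    \<open>undefined\<close>.\<close>
  then show "rescaling K C c (Suc N) (total_diff K C d \<delta> t N x) (p, q)
    = total_diff K C d \<delta> (c \<otimes> t) N (rescaling K C c N x) (p, q)"
    by (auto simp: rescaling_def total_diff_def bidegrees_def)
qed

lemma rescaling_conjugates_total_diff:
  assumes c: "c \<in> Units K" and t: "t \<in> carrier K" and x: "x \<in> carrier (total_complex C N)"
  shows "rescaling K C c (Suc N)
      (total_diff K C d \<delta> t N (inv_into (carrier (total_complex C N)) (rescaling K C c N) x))
    = total_diff K C d \<delta> (c \<otimes> t) N x"
proof -
  \<comment> \<open>Surjectivity makes \<open>inv_into\<close> a genuine preimage of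
    \<open>x\<close>: the intertwining relation applies to it, and \<open>f_inv_into_f\<close> then
    cancels the rescaling on the right.\<close>
  have "x \<in> rescaling K C c N ` carrier (total_complex C N)"
    using x rescaling_bij[OF c] by (simp add: bij_betw_def)
  then show ?thesis
    using c t by (simp add: rescaling_total_diff inv_into_into f_inv_into_f Units_closed)
qed

text \<open>The intertwining relation makes \<open>rescaling K C c\<close> a chain map between two
  differentials on the same graded space.\<close>

lemma lin_isomorphic_cohomology_rescaled:
  assumes c: "c \<in> Units K" and t: "t \<in> carrier K"
  shows "lin_isomorphic K (cohomology (total_complex C) (total_diff K C d \<delta> t) N)
    (cohomology (total_complex C) (total_diff K C d \<delta> (c \<otimes> t)) N)"
  using c t
  by (intro lin_isomorphic_cohomology[where f = "rescaling K C c"] total_complex_module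
      total_diff_closed rescaling_lin_iso rescaling_total_diff) (auto simp: Units_closed)

end

theorem theorem9p1:
  fixes K :: "('k, 'm) ring_scheme"
    and C :: "nat \<Rightarrow> nat \<Rightarrow> ('k, 'v) module"
    and d \<delta> :: "nat \<Rightarrow> nat \<Rightarrow> 'v \<Rightarrow> 'v"
    and t :: 'k
  assumes "bicomplex K C d \<delta>" and "char_zero K" and "t \<in> carrier K"
  shows "(\<forall>N. sign_twist K C N \<in> lin_iso K (total_complex C N) (total_complex C N)) \<and>
    (\<forall>N. \<forall>x\<in>carrier (total_complex C N).
       sign_twist K C (Suc N)
         (total_diff K C d \<delta> t N (inv_into (carrier (total_complex C N)) (sign_twist K C N) x))
       = total_diff K C d \<delta> (\<ominus>\<^bsub>K\<^esub> t) N x) \<and>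
    (\<forall>c\<in>Units K.
      (\<forall>N. rescaling K C c N \<in> lin_iso K (total_complex C N) (total_complex C N)) \<and>
      (\<forall>N. \<forall>x\<in>carrier (total_complex C N).
         rescaling K C c (Suc N)
           (total_diff K C d \<delta> t N (inv_into (carrier (total_complex C N)) (rescaling K C c N) x))
         = total_diff K C d \<delta> (c \<otimes>\<^bsub>K\<^esub> t) N x)) \<and>
    (t \<noteq> \<zero>\<^bsub>K\<^esub> \<longrightarrow>
      (\<forall>N. lin_isomorphic K
             (cohomology (total_complex C) (total_diff K C d \<delta> t) N)
             (cohomology (total_complex C) (total_diff K C d \<delta> (\<ominus>\<^bsub>K\<^esub> t)) N) \<and>
           lin_isomorphic K
             (cohomology (total_complex C) (total_diff K C d \<delta> (\<ominus>\<^bsub>K\<^esub> t)) N)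
             (cohomology (total_complex C) (total_diff K C d \<delta> \<one>\<^bsub>K\<^esub>) N)))"
proof -
  interpret bicomplex K C d \<delta> by fact
  note t = \<open>t \<in> carrier K\<close>
  have unit: "\<ominus>\<^bsub>K\<^esub> \<one>\<^bsub>K\<^esub> \<in> Units K"
    by (simp add: field_Units)
  have neg: "\<ominus>\<^bsub>K\<^esub> \<one>\<^bsub>K\<^esub> \<otimes>\<^bsub>K\<^esub> t = \<ominus>\<^bsub>K\<^esub> t"
    using t by (simp add: l_minus)
  have "lin_isomorphic K (cohomology (total_complex C) (total_diff K C d \<delta> (\<ominus>\<^bsub>K\<^esub> t)) N)
      (cohomology (total_complex C) (total_diff K C d \<delta> \<one>\<^bsub>K\<^esub>) N)" if "t \<noteq> \<zero>\<^bsub>K\<^esub>" for N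
  proof -
    \<comment> \<open>The second isomorphism starts from the parameter \<open>\<ominus> t\<close>,
      so rescaling by its inverse ends at \<open>\<one>\<close>; this is where \<open>t\<close> must
      be nonzero.\<close>
    have u: "\<ominus>\<^bsub>K\<^esub> t \<in> Units K"
      using t that by (simp add: field_Units)
    show ?thesis
      using lin_isomorphic_cohomology_rescaled[OF Units_inv_Units[OF u], of "\<ominus>\<^bsub>K\<^esub> t" N] u t
      by simp
  qed
  then show ?thesis
    unfolding sign_twist_eq_rescaling
    using rescaling_lin_iso rescaling_conjugates_total_diff[OF _ t]
      lin_isomorphic_cohomology_rescaled[OF unit t] unit neg
    by (metis (no_types, lifting))
qed

end
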